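(* Let $p\in\{1,\dots,r\}$ and let $P$ be the maximal parabolic subgroup of $G$ corresponding to $\alpha_p$. For $(k,h)\in\mathbb{Z}^2$ put $$M_p(k,h)=\max_{\substack{w\in W\\ \Delta_p\subset w^{-1}(\Delta\cup\Phi_-)}}\bigl(\sharp\{\alpha\in w^{-1}\Phi_-:\langle\lambda_p,\alpha^\vee\rangle=k,\ \mathrm{ht}\,\alpha^\vee=h-1\}-\sharp\{\alpha\in w^{-1}\Phi_-:\langle\lambda_p,\alpha^\vee\rangle=k,\ \mathrm{ht}\,\alpha^\vee=h\}\bigr).$$ Then $$\xi^{G/P}_{\mathbb{Q};o}(s;T)=\omega^{G/P}_{\mathbb{Q}}(s;T)\prod_{k=0}^\infty\prod_{h=2}^\infty\xi(ks+h)^{M_p(k,h)}.$$ (Here $M_p(k,h)\ne0$ for only finitely many pairs $(k,h)$, and the product is understood as a finite product.)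
   Context: **Root systems.** $G$ is a semisimple algebraic group of rank $r$ over $\mathbb{Q}$ with root system $\Phi$; everything below depends only on $\Phi$, $\Delta$ and the index $p$. $V$ is an $r$-dimensional real vector space with inner product $\langle\cdot,\cdot\rangle$ (extended bilinearly to $V\otimes\mathbb{C}$), $\Phi\subset V$ a (reduced, crystallographic) root system of rank $r$, $\Delta=\{\alpha_1,\dots,\alpha_r\}$ a fundamental system, $\Phi_+$ the corresponding positive system, $\Phi_-=-\Phi_+$, $\alpha^\vee=2\alpha/\langle\alpha,\alpha\rangle$, and $\lambda_1,\dots,\lambda_r$ the fundamental weights, $\langle\alpha_i^\vee,\lambda_j\rangle=\delta_{ij}$. $\rho=\frac12\sum_{\alpha\in\Phi_+}\alpha=\sum_j\lambda_j$ and $\mathrm{ht}\,\alpha^\vee=\langle\rho,\alpha^\vee\rangle$. $W$ is the Weyl group, $\Phi_w=\Phi_+\cap w^{-1}\Phi_-$ for $w\in W$, and $\Delta_p=\Delta\setminus\{\alpha_p\}$. **Periods.** $\xi(s)=\pi^{-s/2}\Gamma(s/2)\zeta(s)$ with $\zeta$ the Riemann zeta function. For $\lambda,T$, $$\omega^G_{\mathbb{Q}}(\lambda;T)=\sum_{w\in W}e^{\langle w\lambda-\rho,T\rangle}\Bigl(\prod_{\alpha\in\Delta}\frac{1}{\langle w\lambda-\rho,\alpha^\vee\rangle}\Bigr)\Bigl(\prod_{\alpha\in\Phi_w}\frac{\xi(\langle\lambda,\alpha^\vee\rangle)}{\xi(\langle\lambda,\alpha^\vee\rangle+1)}\Bigr).$$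 Writing $\lambda=\rho+\sum_k s_k\lambda_k$ with complex coordinates $s_k=\langle\lambda-\rho,\alpha_k^\vee\rangle$ and $s=s_p$, $\omega^{G/P}_{\mathbb{Q}}(s;T)$ is the iterated residue of $\omega^G_{\mathbb{Q}}(\lambda;T)$ at $s_k=0$ for all $k\ne p$. Taken term by term, it is a sum over those $w\in W$ with $\Delta_p\subset w^{-1}(\Delta\cup\Phi_-)$ (call these admissible), the $w$-term being $$e^{\langle w(\rho+s\lambda_p)-\rho,T\rangle}\Bigl(\prod_{\alpha\in(w^{-1}\Delta)\setminus\Delta_p}\frac{1}{\langle\lambda_p,\alpha^\vee\rangle s+\mathrm{ht}\,\alpha^\vee-1}\Bigr)H_{p,w}(s),$$ $$H_{p,w}(s)=\prod_{\alpha\in\Phi_w\setminus\Delta_p}\xi(\langle\lambda_p,\alpha^\vee\rangle s+\mathrm{ht}\,\alpha^\vee)\prod_{\alpha\in\Phi_w}\frac{1}{\xi(\langle\lambda_p,\alpha^\vee\rangle s+\mathrm{ht}\,\alpha^\vee+1)}.$$ **Weng's zeta function.** $\xi^{G/P}_{\mathbb{Q};o}(s;T)$ is obtained from $\omega^{G/P}_{\mathbb{Q}}(s;T)$ by multiplying by the minimal product of $\xi$ functions cancelling all $\xi$-denominators. Precisely: after formal cancellation, $H_{p,w}(s)=\prod_{k\ge0,\,h\ge1}\xi(ks+h)^{e_{p,w}(k,h)}$ with $$e_{p,w}(k,h)=\sharp\{\alpha\in\Phi_w\setminus\Delta_p:\langle\lambda_p,\alpha^\vee\rangle=k,\ \mathrm{ht}\,\alpha^\vee=h\}-\sharp\{\alpha\in\Phi_w:\langle\lambda_p,\alpha^\vee\rangle=k,\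 \mathrm{ht}\,\alpha^\vee=h-1\},$$ and $$\xi^{G/P}_{\mathbb{Q};o}(s;T)=\omega^{G/P}_{\mathbb{Q}}(s;T)\prod_{k\ge0,\,h\ge1}\xi(ks+h)^{m_p(k,h)},\qquad m_p(k,h)=\max_{w\text{ admissible}}\max(0,-e_{p,w}(k,h)),$$ a product with only finitely many nontrivial factors. *)

theory Defs
  imports "HOL-Complex_Analysis.Complex_Analysis"
begin

section \<open>The completed Riemann zeta function\<close>

text \<open>
  The Riemann zeta function is the analytic continuation of its Dirichlet series to the plane
  without the point 1; the value 0 at the pole is a convention.
\<close>

definition zeta :: "complex \<Rightarrow> complex" where
  "zeta = (THE f. f holomorphic_on (- {1}) \<and> f 1 = 0 \<and>
     (\<forall>s. Re s > 1 \<longrightarrow> (\<lambda>n. 1 / of_nat (Suc n) powr s) sums f s))"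

text \<open>
  At \<open>-2, -4, \<dots>\<close> the poles of the Gamma factor cancel against zeros of zeta.  The
  library gives \<open>Gamma\<close> the value 0 at its poles, so these removable singularities have to
  be filled in.
\<close>

definition xi :: "complex \<Rightarrow> complex" where
  "xi = remove_sings (\<lambda>s. of_real pi powr (- s / 2) * Gamma (s / 2) * zeta s)"


section \<open>Root systems\<close>

definition coroot :: "'a::euclidean_space \<Rightarrow> 'a" where
  "coroot \<alpha> = (2 / (\<alpha> \<bullet> \<alpha>)) *\<^sub>R \<alpha>"

definition refl_root :: "'a::euclidean_space \<Rightarrow> 'a \<Rightarrow> 'a" where
  "refl_root \<alpha> x = x - (x \<bullet> coroot \<alpha>) *\<^sub>R \<alpha>"

definition root_system :: "'a::euclidean_space set \<Rightarrow> bool" where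
  "root_system \<Phi> \<longleftrightarrow>
     finite \<Phi> \<and> 0 \<notin> \<Phi> \<and> span \<Phi> = UNIV \<and>
     (\<forall>\<alpha>\<in>\<Phi>. \<forall>\<beta>\<in>\<Phi>. refl_root \<alpha> \<beta> \<in> \<Phi>) \<and>
     (\<forall>\<alpha>\<in>\<Phi>. \<forall>\<beta>\<in>\<Phi>. \<beta> \<bullet> coroot \<alpha> \<in> \<int>) \<and>
     (\<forall>\<alpha>\<in>\<Phi>. \<forall>c. c *\<^sub>R \<alpha> \<in> \<Phi> \<longrightarrow> c = 1 \<or> c = -1)"

text \<open>A fundamental system comes with its numbering \<open>a 1, \<dots>, a r\<close>, where
  \<open>r = DIM('a)\<close> is the rank.\<close>

definition simple_roots :: "(nat \<Rightarrow> 'a::euclidean_space) \<Rightarrow> 'a set" where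
  "simple_roots a = a ` {1..DIM('a)}"

definition fundamental_system :: "'a::euclidean_space set \<Rightarrow> (nat \<Rightarrow> 'a) \<Rightarrow> bool" where
  "fundamental_system \<Phi> a \<longleftrightarrow>
     inj_on a {1..DIM('a)} \<and> simple_roots a \<subseteq> \<Phi> \<and> independent (simple_roots a) \<and>
     (\<forall>\<beta>\<in>\<Phi>. \<exists>c :: nat \<Rightarrow> int. \<beta> = (\<Sum>i=1..DIM('a). of_int (c i) *\<^sub>R a i) \<and>
        ((\<forall>i\<in>{1..DIM('a)}. c i \<ge> 0) \<or> (\<forall>i\<in>{1..DIM('a)}. c i \<le> 0)))"

definition pos_roots :: "'a::euclidean_space set \<Rightarrow> (nat \<Rightarrow> 'a) \<Rightarrow> 'a set" where
  "pos_roots \<Phi> a = {\<beta>\<in>\<Phi>. \<exists>c :: nat \<Rightarrow> nat. \<beta> = (\<Sum>i=1..DIM('a). of_nat (c i) *\<^sub>R a i)}"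

definition neg_roots :: "'a::euclidean_space set \<Rightarrow> (nat \<Rightarrow> 'a) \<Rightarrow> 'a set" where
  "neg_roots \<Phi> a = uminus ` pos_roots \<Phi> a"

definition fund_weight :: "(nat \<Rightarrow> 'a::euclidean_space) \<Rightarrow> nat \<Rightarrow> 'a" where
  "fund_weight a j = (THE x. \<forall>i\<in>{1..DIM('a)}. coroot (a i) \<bullet> x = (if i = j then 1 else 0))"

definition weyl_vector :: "'a::euclidean_space set \<Rightarrow> (nat \<Rightarrow> 'a) \<Rightarrow> 'a" where
  "weyl_vector \<Phi> a = (1 / 2) *\<^sub>R (\<Sum>\<beta>\<in>pos_roots \<Phi> a. \<beta>)"

definition coroot_height :: "'a::euclidean_space set \<Rightarrow> (nat \<Rightarrow> 'a) \<Rightarrow> 'a \<Rightarrow> real" where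
  "coroot_height \<Phi> a \<beta> = weyl_vector \<Phi> a \<bullet> coroot \<beta>"

text \<open>Reflections are involutions, so the monoid they generate is the generated group.\<close>

inductive_set weyl_group :: "'a::euclidean_space set \<Rightarrow> ('a \<Rightarrow> 'a) set" for \<Phi> where
  id: "id \<in> weyl_group \<Phi>"
| comp: "\<alpha> \<in> \<Phi> \<Longrightarrow> w \<in> weyl_group \<Phi> \<Longrightarrow> refl_root \<alpha> \<circ> w \<in> weyl_group \<Phi>"

text \<open>Since Weyl group elements are bijective, the set \<open>w\<^sup>-\<^sup>1 S\<close> of the literature is
  the preimage \<open>w -` S\<close>.\<close>

definition inversion_set :: "'a::euclidean_space set \<Rightarrow> (nat \<Rightarrow> 'a) \<Rightarrow> ('a \<Rightarrow> 'a) \<Rightarrow> 'a set" where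
  "inversion_set \<Phi> a w = pos_roots \<Phi> a \<inter> w -` neg_roots \<Phi> a"

text \<open>\<open>simple_roots_except a p\<close> is \<open>\<Delta>\<^sub>p\<close>.\<close>

definition simple_roots_except :: "(nat \<Rightarrow> 'a::euclidean_space) \<Rightarrow> nat \<Rightarrow> 'a set" where
  "simple_roots_except a p = simple_roots a - {a p}"

definition admissible :: "'a::euclidean_space set \<Rightarrow> (nat \<Rightarrow> 'a) \<Rightarrow> nat \<Rightarrow> ('a \<Rightarrow> 'a) set" where
  "admissible \<Phi> a p =
     {w \<in> weyl_group \<Phi>. simple_roots_except a p \<subseteq> w -` (simple_roots a \<union> neg_roots \<Phi> a)}"

text \<open>The Weyl group is finite, so that sums over it are genuine.\<close>

lemma linear_refl_root: "linear (refl_root \<alpha>)"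
  unfolding refl_root_def
  by (auto intro!: linearI simp: inner_add_left inner_left_distrib algebra_simps)

lemma weyl_group_linear: "w \<in> weyl_group \<Phi> \<Longrightarrow> linear w"
proof (induction rule: weyl_group.induct)
  case id
  show ?case by (intro linearI) auto
next
  case (comp \<alpha> w)
  then show ?case by (intro linear_compose linear_refl_root)
qed

lemma weyl_group_root:
  assumes "root_system \<Phi>" "w \<in> weyl_group \<Phi>" "\<beta> \<in> \<Phi>"
  shows "w \<beta> \<in> \<Phi>"
  using assms(2,3) by (induction rule: weyl_group.induct) (use assms(1) in \<open>auto simp: root_system_def\<close>)

lemma finite_weyl_group:
  assumes "root_system \<Phi>"
  shows "finite (weyl_group \<Phi>)"
proof (rule inj_on_finite)
  show "inj_on (\<lambda>w. restrict w \<Phi>) (weyl_group \<Phi>)"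
  proof (rule inj_onI)
    fix v w assume vw: "v \<in> weyl_group \<Phi>" "w \<in> weyl_group \<Phi>" "restrict v \<Phi> = restrict w \<Phi>"
    have eq: "v x = w x" if "x \<in> \<Phi>" for x
      using that vw(3) by (metis restrict_apply')
    show "v = w"
    proof
      fix x
      have "x \<in> span \<Phi>" using assms by (simp add: root_system_def)
      then show "v x = w x"
        using linear_eq_on[OF weyl_group_linear[OF vw(1)] weyl_group_linear[OF vw(2)]] eq by blast
    qed
  qed
  show "(\<lambda>w. restrict w \<Phi>) ` weyl_group \<Phi> \<subseteq> \<Phi> \<rightarrow>\<^sub>E \<Phi>"
    using weyl_group_root[OF assms] by auto
  show "finite (\<Phi> \<rightarrow>\<^sub>E \<Phi>)"
    using assms by (auto simp: root_system_def intro: finite_PiE)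
qed


section \<open>The complexification\<close>

text \<open>The complexification of the Euclidean space \<open>'a\<close> is modelled by \<open>'a \<times> 'a\<close>, the
  pair \<open>(x, y)\<close> standing for \<open>x + \<i> y\<close>.  A real linear map \<open>w\<close> extends to
  \<open>map_prod w w\<close>, and the inner product extends to the complex bilinear (not sesquilinear)
  form \<open>cinner\<close>.\<close>

definition cvec :: "'a::euclidean_space \<Rightarrow> 'a \<times> 'a" where
  "cvec x = (x, 0)"

definition cscale :: "complex \<Rightarrow> 'a::euclidean_space \<times> 'a \<Rightarrow> 'a \<times> 'a" where
  "cscale c v = (Re c *\<^sub>R fst v - Im c *\<^sub>R snd v, Im c *\<^sub>R fst v + Re c *\<^sub>R snd v)"

definition cinner :: "'a::euclidean_space \<times> 'a \<Rightarrow> 'a \<times> 'a \<Rightarrow> complex" where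
  "cinner u v = Complex (fst u \<bullet> fst v - snd u \<bullet> snd v) (fst u \<bullet> snd v + snd u \<bullet> fst v)"


section \<open>Periods\<close>

definition omega_G ::
    "'a::euclidean_space set \<Rightarrow> (nat \<Rightarrow> 'a) \<Rightarrow> 'a \<times> 'a \<Rightarrow> 'a \<times> 'a \<Rightarrow> complex" where
  "omega_G \<Phi> a l T = (\<Sum>w\<in>weyl_group \<Phi>.
     exp (cinner (map_prod w w l - cvec (weyl_vector \<Phi> a)) T) *
     (\<Prod>\<beta>\<in>simple_roots a.
        1 / cinner (map_prod w w l - cvec (weyl_vector \<Phi> a)) (cvec (coroot \<beta>))) *
     (\<Prod>\<beta>\<in>inversion_set \<Phi> a w.
        xi (cinner l (cvec (coroot \<beta>))) / xi (cinner l (cvec (coroot \<beta>)) + 1)))"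

text \<open>Iterated residue at 0 in the coordinates listed in \<open>ks\<close>, the head of the list first;
  the coordinates not in the list are kept fixed.\<close>

fun iterated_residue ::
    "nat list \<Rightarrow> ((nat \<Rightarrow> complex) \<Rightarrow> complex) \<Rightarrow> (nat \<Rightarrow> complex) \<Rightarrow> complex" where
  "iterated_residue [] f s = f s"
| "iterated_residue (k # ks) f s = iterated_residue ks (\<lambda>s'. residue (\<lambda>z. f (s'(k := z))) 0) s"

text \<open>For generic \<open>s\<close>, each Weyl group term is near the point in question a holomorphic function
  divided by a product of distinct coordinates, so that the order of the residues is immaterial.\<close>

definition omega_GP ::
    "'a::euclidean_space set \<Rightarrow> (nat \<Rightarrow> 'a) \<Rightarrow> nat \<Rightarrow> complex \<Rightarrow> 'a \<times> 'a \<Rightarrow> complex" where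
  "omega_GP \<Phi> a p s T = iterated_residue [k \<leftarrow> [1..<Suc DIM('a)]. k \<noteq> p]
     (\<lambda>c. omega_G \<Phi> a
        (cvec (weyl_vector \<Phi> a) + (\<Sum>k=1..DIM('a). cscale (c k) (cvec (fund_weight a k)))) T)
     ((\<lambda>_. 0)(p := s))"


section \<open>Weng's zeta function\<close>

text \<open>\<open>roots_at \<Phi> a p S k h\<close> consists of those \<open>\<beta>\<close> in \<open>S\<close> whose factor
  \<open>xi (\<langle>\<lambda>\<^sub>p, \<beta>\<^sup>\<or>\<rangle> s + ht \<beta>\<^sup>\<or>)\<close> is \<open>xi (k s + h)\<close>.\<close>

definition roots_at ::
    "'a::euclidean_space set \<Rightarrow> (nat \<Rightarrow> 'a) \<Rightarrow> nat \<Rightarrow> 'a set \<Rightarrow> int \<Rightarrow> int \<Rightarrow> 'a set" where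
  "roots_at \<Phi> a p S k h =
     {\<beta>\<in>S. fund_weight a p \<bullet> coroot \<beta> = of_int k \<and> coroot_height \<Phi> a \<beta> = of_int h}"

text \<open>The exponent of \<open>xi (k s + h)\<close> in the \<open>w\<close>-term of \<open>omega_GP\<close>, after formal
  cancellation.  Numerators are \<open>xi (\<langle>\<lambda>\<^sub>p, \<beta>\<^sup>\<or>\<rangle> s + ht \<beta>\<^sup>\<or>)\<close>, where the roots of \<open>\<Delta>\<^sub>p\<close>
  have been used up by the residues; denominators are
  \<open>xi (\<langle>\<lambda>\<^sub>p, \<beta>\<^sup>\<or>\<rangle> s + ht \<beta>\<^sup>\<or> + 1)\<close>, hence the shift of \<open>h\<close>.\<close>

definition term_exponent ::
    "'a::euclidean_space set \<Rightarrow> (nat \<Rightarrow> 'a) \<Rightarrow> nat \<Rightarrow> ('a \<Rightarrow> 'a) \<Rightarrow> int \<Rightarrow> int \<Rightarrow> int" where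
  "term_exponent \<Phi> a p w k h =
     int (card (roots_at \<Phi> a p (inversion_set \<Phi> a w - simple_roots_except a p) k h)) -
     int (card (roots_at \<Phi> a p (inversion_set \<Phi> a w) k (h - 1)))"

definition min_exponent ::
    "'a::euclidean_space set \<Rightarrow> (nat \<Rightarrow> 'a) \<Rightarrow> nat \<Rightarrow> int \<Rightarrow> int \<Rightarrow> int" where
  "min_exponent \<Phi> a p k h =
     (MAX w\<in>admissible \<Phi> a p. max 0 (- term_exponent \<Phi> a p w k h))"

definition xi_GP ::
    "'a::euclidean_space set \<Rightarrow> (nat \<Rightarrow> 'a) \<Rightarrow> nat \<Rightarrow> complex \<Rightarrow> 'a \<times> 'a \<Rightarrow> complex" where
  "xi_GP \<Phi> a p s T = omega_GP \<Phi> a p s T *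
     (\<Prod>(k, h) \<in> {(k, h). k \<ge> 0 \<and> h \<ge> 1 \<and> min_exponent \<Phi> a p k h \<noteq> 0}.
        xi (of_int k * s + of_int h) powi min_exponent \<Phi> a p k h)"

definition M_exponent ::
    "'a::euclidean_space set \<Rightarrow> (nat \<Rightarrow> 'a) \<Rightarrow> nat \<Rightarrow> int \<Rightarrow> int \<Rightarrow> int" where
  "M_exponent \<Phi> a p k h =
     (MAX w\<in>admissible \<Phi> a p.
        int (card (roots_at \<Phi> a p (w -` neg_roots \<Phi> a) k (h - 1))) -
        int (card (roots_at \<Phi> a p (w -` neg_roots \<Phi> a) k h)))"

end

theory Submission
  imports Defs
begin

text \<open>
  The period is a common factor, and the two products that multiply it turn out to have the same
  exponents.  The link between
  \<open>inversion_set \<Phi> a w\<close>, which governs the exponents of the \<open>w\<close>-term, and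
  \<open>w -` neg_roots \<Phi> a\<close>, which governs \<open>M_exponent\<close>, is the height of coroots:
  it is positive on positive roots, negative on negative roots and 1 on simple roots.  Both signs
  come from \<open>\<langle>\<rho>, \<alpha>\<^sub>i\<^sup>\<or>\<rangle> = 1\<close> (lemma \<open>coroot_height_simple\<close>), which
  holds because the reflection in \<open>\<alpha>\<^sub>i\<close> permutes the positive roots other than
  \<open>\<alpha>\<^sub>i\<close> (lemma \<open>refl_root_simple_permutes\<close>) and changes the sign of the pairing with
  \<open>\<alpha>\<^sub>i\<^sup>\<or>\<close>.

  For \<open>h \<ge> 2\<close> the heights \<open>h\<close> and \<open>h - 1\<close> are both positive, so every root of
  such a height is positive, and a root of height \<open>h\<close> is not simple.  Hence restricting
  \<open>w -` neg_roots \<Phi> a\<close> to positive roots and removing \<open>\<Delta>\<^sub>p\<close> change nothing, and minus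
  the exponent of the \<open>w\<close>-term is the difference maximized in \<open>M_exponent\<close> (lemma \<open>term_exponent_eq\<close>).  Truncating at 0 does
  not matter either, since the admissible element \<open>w = id\<close> contributes 0: no negative root has
  positive height.  For \<open>h = 1\<close> a denominator would need a positive root of height 0; there is
  none, so the minimal exponent vanishes and the product may start at \<open>h = 2\<close>.
\<close>

section \<open>Positive roots and simple reflections\<close>

lemma refl_root_involution:
  assumes "\<alpha> \<noteq> 0"
  shows "refl_root \<alpha> (refl_root \<alpha> x) = x"
proof -
  have "\<alpha> \<bullet> coroot \<alpha> = 2"
    using assms by (simp add: coroot_def)
  then show ?thesis
    by (simp add: refl_root_def inner_diff_left algebra_simps)
qed

lemma inner_refl_root_coroot:
  assumes "\<alpha> \<noteq> 0"
  shows "refl_root \<alpha> x \<bullet> coroot \<alpha> = - (x \<bullet> coroot \<alpha>)"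
proof -
  have "\<alpha> \<bullet> coroot \<alpha> = 2"
    using assms by (simp add: coroot_def)
  then show ?thesis
    by (simp add: refl_root_def inner_diff_left)
qed

lemma coroot_uminus: "coroot (- \<beta>) = - coroot \<beta>"
  by (simp add: coroot_def)

lemma coroot_height_uminus: "coroot_height \<Phi> a (- \<beta>) = - coroot_height \<Phi> a \<beta>"
  by (simp add: coroot_height_def coroot_uminus)

locale based_root_system =
  fixes \<Phi> :: "'a::euclidean_space set" and a :: "nat \<Rightarrow> 'a"
  assumes root_system: "root_system \<Phi>" and fundamental_system: "fundamental_system \<Phi> a"
begin

lemma finite_roots: "finite \<Phi>"
  and root_nonzero: "\<beta> \<in> \<Phi> \<Longrightarrow> \<beta> \<noteq> 0"
  and refl_root_in_roots: "\<alpha> \<in> \<Phi> \<Longrightarrow> \<beta> \<in> \<Phi> \<Longrightarrow> refl_root \<alpha> \<beta> \<in> \<Phi>"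
  and root_multiple: "\<alpha> \<in> \<Phi> \<Longrightarrow> c *\<^sub>R \<alpha> \<in> \<Phi> \<Longrightarrow> c = 1 \<or> c = -1"
  using root_system by (auto simp: root_system_def)

lemma simple_root_in_roots: "i \<in> {1..DIM('a)} \<Longrightarrow> a i \<in> \<Phi>"
  using fundamental_system by (auto simp: fundamental_system_def simple_roots_def)

lemma uminus_root:
  assumes "\<beta> \<in> \<Phi>"
  shows "- \<beta> \<in> \<Phi>"
proof -
  have "refl_root \<beta> \<beta> = \<beta> - 2 *\<^sub>R \<beta>"
    using root_nonzero[OF assms] by (simp add: refl_root_def coroot_def)
  also have "\<dots> = - \<beta>"
    by (simp add: scaleR_2)
  finally show ?thesis
    using refl_root_in_roots[OF assms assms] by simp
qed

lemma pos_roots_subset: "pos_roots \<Phi> a \<subseteq> \<Phi>"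
  by (auto simp: pos_roots_def)

lemma neg_roots_subset: "neg_roots \<Phi> a \<subseteq> \<Phi>"
  using pos_roots_subset uminus_root by (auto simp: neg_roots_def)

lemma finite_pos_roots: "finite (pos_roots \<Phi> a)"
  using finite_subset[OF pos_roots_subset finite_roots] .

lemma simple_combination_unique:
  fixes c d :: "nat \<Rightarrow> real"
  assumes "(\<Sum>i=1..DIM('a). c i *\<^sub>R a i) = (\<Sum>i=1..DIM('a). d i *\<^sub>R a i)"
    and "j \<in> {1..DIM('a)}"
  shows "c j = d j"
proof -
  have inj: "inj_on a {1..DIM('a)}" and ind: "independent (a ` {1..DIM('a)})"
    using fundamental_system by (auto simp: fundamental_system_def simple_roots_def)
  define u where "u v = (let i = inv_into {1..DIM('a)} a v in c i - d i)" for v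
  have u: "u (a i) = c i - d i" if "i \<in> {1..DIM('a)}" for i
    using inv_into_f_f[OF inj that] by (simp add: u_def)
  have "(\<Sum>v\<in>a ` {1..DIM('a)}. u v *\<^sub>R v) = (\<Sum>i=1..DIM('a). (c i - d i) *\<^sub>R a i)"
    using u by (subst sum.reindex[OF inj]) (auto intro!: sum.cong)
  also have "\<dots> = 0"
    using assms(1) by (simp add: scaleR_diff_left sum_subtractf)
  finally have "u (a j) = 0"
    using independentD[OF ind _ order.refl, of u "a j"] assms(2) by simp
  then show ?thesis
    using u[OF assms(2)] by simp
qed

lemma root_combination:
  assumes "\<beta> \<in> \<Phi>"
  obtains c :: "nat \<Rightarrow> int" where "\<beta> = (\<Sum>i=1..DIM('a). of_int (c i) *\<^sub>R a i)"
    and "(\<forall>i\<in>{1..DIM('a)}. c i \<ge> 0) \<or> (\<forall>i\<in>{1..DIM('a)}. c i \<le> 0)"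
  using assms fundamental_system unfolding fundamental_system_def by blast

lemma pos_rootI:
  fixes c :: "nat \<Rightarrow> int"
  assumes "\<beta> \<in> \<Phi>" "\<beta> = (\<Sum>i=1..DIM('a). of_int (c i) *\<^sub>R a i)" "\<forall>i\<in>{1..DIM('a)}. c i \<ge> 0"
  shows "\<beta> \<in> pos_roots \<Phi> a"
proof -
  have "\<beta> = (\<Sum>i=1..DIM('a). of_nat (nat (c i)) *\<^sub>R a i)"
    unfolding assms(2) using assms(3) by (intro sum.cong) auto
  then show ?thesis
    using assms(1) unfolding pos_roots_def
    by (intro CollectI conjI exI[where x = "\<lambda>i. nat (c i)"])
qed

lemma pos_or_neg_root:
  assumes "\<beta> \<in> \<Phi>"
  shows "\<beta> \<in> pos_roots \<Phi> a \<or> \<beta> \<in> neg_roots \<Phi> a"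
proof -
  obtain c :: "nat \<Rightarrow> int" where c: "\<beta> = (\<Sum>i=1..DIM('a). of_int (c i) *\<^sub>R a i)"
    and sign: "(\<forall>i\<in>{1..DIM('a)}. c i \<ge> 0) \<or> (\<forall>i\<in>{1..DIM('a)}. c i \<le> 0)"
    using root_combination[OF assms] .
  from sign show ?thesis
  proof
    assume "\<forall>i\<in>{1..DIM('a)}. c i \<ge> 0"
    then show ?thesis
      using pos_rootI[OF assms c] by blast
  next
    assume "\<forall>i\<in>{1..DIM('a)}. c i \<le> 0"
    moreover have "- \<beta> = (\<Sum>i=1..DIM('a). of_int (- c i) *\<^sub>R a i)"
      by (simp add: c sum_negf)
    ultimately have "- \<beta> \<in> pos_roots \<Phi> a"
      using pos_rootI[OF uminus_root[OF assms], of "\<lambda>i. - c i"] by simp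
    then show ?thesis
      unfolding neg_roots_def by (metis image_eqI minus_minus)
  qed
qed

lemma simple_root_combination:
  assumes "i \<in> {1..DIM('a)}"
  shows "a i = (\<Sum>j=1..DIM('a). (if j = i then 1 else 0) *\<^sub>R a j)"
proof -
  have "(\<Sum>j=1..DIM('a). (if j = i then 1 else 0) *\<^sub>R a j) =
      (\<Sum>j=1..DIM('a). if j = i then a j else 0)"
    by (intro sum.cong) auto
  then show ?thesis
    using assms by simp
qed

lemma simple_root_pos:
  assumes "i \<in> {1..DIM('a)}"
  shows "a i \<in> pos_roots \<Phi> a"
proof (rule pos_rootI[OF simple_root_in_roots[OF assms]])
  have "(\<Sum>j=1..DIM('a). (if j = i then 1 else 0) *\<^sub>R a j) =
      (\<Sum>j=1..DIM('a). real_of_int (if j = i then 1 else 0) *\<^sub>R a j)"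
    by (intro sum.cong) auto
  then show "a i = (\<Sum>j=1..DIM('a). of_int (if j = i then 1 else 0) *\<^sub>R a j)"
    using simple_root_combination[OF assms] by simp
qed auto

text \<open>
  The reflection changes only the coefficient of \<open>a i\<close>.  A positive root other than
  \<open>a i\<close> is not a multiple of \<open>a i\<close>, so it has a positive coefficient elsewhere, which
  survives and forces all coefficients of the image to be nonnegative.
\<close>

lemma refl_root_simple_pos:
  assumes i: "i \<in> {1..DIM('a)}" and \<beta>: "\<beta> \<in> pos_roots \<Phi> a" "\<beta> \<noteq> a i"
  shows "refl_root (a i) \<beta> \<in> pos_roots \<Phi> a - {a i}"
proof -
  define n where "n = \<beta> \<bullet> coroot (a i)"
  obtain c :: "nat \<Rightarrow> nat" where c: "\<beta> = (\<Sum>j=1..DIM('a). of_nat (c j) *\<^sub>R a j)"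
    using \<beta>(1) unfolding pos_roots_def by blast
  have \<beta>_root: "\<beta> \<in> \<Phi>"
    using \<beta>(1) pos_roots_subset by blast
  have "\<exists>j\<in>{1..DIM('a)}. j \<noteq> i \<and> c j > 0"
  proof (rule ccontr)
    assume "\<not> ?thesis"
    then have "\<beta> = (\<Sum>j=1..DIM('a). if j = i then real (c i) *\<^sub>R a i else 0)"
      unfolding c by (intro sum.cong) auto
    then have mult: "\<beta> = real (c i) *\<^sub>R a i"
      using i by simp
    then have "real (c i) = 1 \<or> real (c i) = -1"
      using root_multiple[OF simple_root_in_roots[OF i]] \<beta>_root by blast
    then show False
      using mult \<beta>(2) by auto
  qed
  then obtain j where j: "j \<in> {1..DIM('a)}" "j \<noteq> i" "c j > 0"
    by blast
  have refl: "refl_root (a i) \<beta> =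
      (\<Sum>k=1..DIM('a). (real (c k) - n * (if k = i then 1 else 0)) *\<^sub>R a k)"
  proof -
    have "refl_root (a i) \<beta> = (\<Sum>k=1..DIM('a). real (c k) *\<^sub>R a k) -
        n *\<^sub>R (\<Sum>k=1..DIM('a). (if k = i then 1 else 0) *\<^sub>R a k)"
      unfolding refl_root_def n_def[symmetric] simple_root_combination[OF i, symmetric]
      using c by simp
    then show ?thesis
      by (simp only: scaleR_diff_left sum_subtractf scaleR_sum_right scaleR_scaleR)
  qed
  have in_roots: "refl_root (a i) \<beta> \<in> \<Phi>"
    using refl_root_in_roots[OF simple_root_in_roots[OF i] \<beta>_root] .
  obtain d :: "nat \<Rightarrow> int" where d: "refl_root (a i) \<beta> = (\<Sum>k=1..DIM('a). of_int (d k) *\<^sub>R a k)"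
    and sign: "(\<forall>k\<in>{1..DIM('a)}. d k \<ge> 0) \<or> (\<forall>k\<in>{1..DIM('a)}. d k \<le> 0)"
    using root_combination[OF in_roots] .
  have "real (c j) - n * (if j = i then 1 else 0) = of_int (d j)"
    by (rule simple_combination_unique[OF _ j(1)]) (use refl d in simp)
  then have "d j > 0"
    using j by simp
  then have "\<forall>k\<in>{1..DIM('a)}. d k \<ge> 0"
    using sign j(1) by force
  then have "refl_root (a i) \<beta> \<in> pos_roots \<Phi> a"
    using pos_rootI[OF in_roots d] by blast
  moreover have "refl_root (a i) \<beta> \<noteq> a i"
  proof
    assume "refl_root (a i) \<beta> = a i"
    then have "(\<Sum>k=1..DIM('a). of_int (d k) *\<^sub>R a k) =
        (\<Sum>k=1..DIM('a). (if k = i then 1 else 0) *\<^sub>R a k)"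
      using d simple_root_combination[OF i] by simp
    then have "real_of_int (d j) = (if j = i then 1 else 0)"
      by (rule simple_combination_unique[OF _ j(1)])
    then show False
      using \<open>d j > 0\<close> j(2) by simp
  qed
  ultimately show ?thesis
    by blast
qed

lemma refl_root_simple_permutes:
  assumes i: "i \<in> {1..DIM('a)}"
  shows "bij_betw (refl_root (a i)) (pos_roots \<Phi> a - {a i}) (pos_roots \<Phi> a - {a i})"
proof (rule bij_betw_byWitness[where f' = "refl_root (a i)"])
  have "a i \<noteq> 0"
    using root_nonzero[OF simple_root_in_roots[OF i]] .
  then show "\<forall>x\<in>pos_roots \<Phi> a - {a i}. refl_root (a i) (refl_root (a i) x) = x"
    and "\<forall>x\<in>pos_roots \<Phi> a - {a i}. refl_root (a i) (refl_root (a i) x) = x"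
    by (simp_all add: refl_root_involution)
qed (use refl_root_simple_pos[OF i] in auto)

section \<open>Heights of coroots\<close>

text \<open>
  In the sum of the pairings of the positive roots with \<open>(a i)\<^sup>\<or>\<close>, the terms other than
  that of \<open>a i\<close> cancel: reflecting in \<open>a i\<close> permutes them and negates their sum.
  Only \<open>\<langle>\<alpha>\<^sub>i, \<alpha>\<^sub>i\<^sup>\<or>\<rangle> = 2\<close> is left, which the factor
  \<open>1 / 2\<close> in \<open>\<rho>\<close> turns into 1.
\<close>

lemma coroot_height_simple:
  assumes i: "i \<in> {1..DIM('a)}"
  shows "coroot_height \<Phi> a (a i) = 1"
proof -
  have nz: "a i \<noteq> 0"
    using root_nonzero[OF simple_root_in_roots[OF i]] .
  let ?P = "pos_roots \<Phi> a - {a i}"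
  have "(\<Sum>\<beta>\<in>?P. \<beta> \<bullet> coroot (a i)) = (\<Sum>\<beta>\<in>?P. refl_root (a i) \<beta> \<bullet> coroot (a i))"
    by (rule sum.reindex_bij_betw[OF refl_root_simple_permutes[OF i], symmetric])
  also have "\<dots> = - (\<Sum>\<beta>\<in>?P. \<beta> \<bullet> coroot (a i))"
    by (simp add: inner_refl_root_coroot[OF nz] sum_negf)
  finally have rest: "(\<Sum>\<beta>\<in>?P. \<beta> \<bullet> coroot (a i)) = 0"
    by simp
  have "coroot_height \<Phi> a (a i) = (\<Sum>\<beta>\<in>pos_roots \<Phi> a. \<beta> \<bullet> coroot (a i)) / 2"
    by (simp add: coroot_height_def weyl_vector_def inner_sum_left)
  also have "\<dots> = (a i \<bullet> coroot (a i)) / 2"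
    using rest sum.remove[OF finite_pos_roots simple_root_pos[OF i], of "\<lambda>\<beta>. \<beta> \<bullet> coroot (a i)"]
    by simp
  also have "\<dots> = 1"
    using nz by (simp add: coroot_def)
  finally show ?thesis .
qed

text \<open>
  The coroot of \<open>\<beta>\<close> is a positive multiple of \<open>\<beta>\<close>, so its height has the sign of
  \<open>\<langle>\<rho>, \<beta>\<rangle>\<close>; expanding \<open>\<beta>\<close> in simple roots avoids expanding its coroot in
  simple coroots.
\<close>

lemma coroot_height_pos:
  assumes "\<beta> \<in> pos_roots \<Phi> a"
  shows "coroot_height \<Phi> a \<beta> > 0"
proof -
  obtain c :: "nat \<Rightarrow> nat" where c: "\<beta> = (\<Sum>i=1..DIM('a). of_nat (c i) *\<^sub>R a i)"
    using assms unfolding pos_roots_def by blast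
  have nz: "\<beta> \<noteq> 0"
    using assms pos_roots_subset root_nonzero by blast
  have simple: "weyl_vector \<Phi> a \<bullet> a i > 0" if i: "i \<in> {1..DIM('a)}" for i
  proof -
    have pos: "a i \<bullet> a i > 0"
      using root_nonzero[OF simple_root_in_roots[OF i]] by simp
    have "coroot_height \<Phi> a (a i) = 2 * (weyl_vector \<Phi> a \<bullet> a i) / (a i \<bullet> a i)"
      by (simp add: coroot_height_def coroot_def)
    then have "2 * (weyl_vector \<Phi> a \<bullet> a i) = a i \<bullet> a i"
      using coroot_height_simple[OF i] pos by (metis divide_eq_1_iff)
    then show ?thesis
      using pos by linarith
  qed
  have "\<exists>i\<in>{1..DIM('a)}. c i \<noteq> 0"
  proof (rule ccontr)
    assume "\<not> ?thesis"
    then have "\<beta> = 0"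
      unfolding c by (intro sum.neutral) auto
    then show False
      using nz by simp
  qed
  then obtain i where i: "i \<in> {1..DIM('a)}" "c i \<noteq> 0"
    by blast
  have "0 < (\<Sum>i=1..DIM('a). real (c i) * (weyl_vector \<Phi> a \<bullet> a i))"
  proof (rule sum_pos2[OF _ i(1)])
    show "0 < real (c i) * (weyl_vector \<Phi> a \<bullet> a i)"
      using i simple by simp
    show "0 \<le> real (c k) * (weyl_vector \<Phi> a \<bullet> a k)" if "k \<in> {1..DIM('a)}" for k
      using simple[OF that] by simp
  qed simp
  also have "\<dots> = weyl_vector \<Phi> a \<bullet> \<beta>"
    by (simp add: c inner_sum_right)
  finally have "weyl_vector \<Phi> a \<bullet> \<beta> > 0" .
  moreover have "\<beta> \<bullet> \<beta> > 0"
    using nz by simp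
  ultimately show ?thesis
    by (simp add: coroot_height_def coroot_def)
qed

lemma coroot_height_neg:
  assumes "\<beta> \<in> neg_roots \<Phi> a"
  shows "coroot_height \<Phi> a \<beta> < 0"
proof -
  obtain \<gamma> where "\<gamma> \<in> pos_roots \<Phi> a" "\<beta> = - \<gamma>"
    using assms unfolding neg_roots_def by blast
  then show ?thesis
    using coroot_height_pos[of \<gamma>] by (simp only: coroot_height_uminus neg_less_0_iff_less)
qed

lemma pos_root_of_height_pos:
  assumes "\<beta> \<in> \<Phi>" "coroot_height \<Phi> a \<beta> > 0"
  shows "\<beta> \<in> pos_roots \<Phi> a"
  using pos_or_neg_root[OF assms(1)] coroot_height_neg[of \<beta>] assms(2) by (metis less_asym)

section \<open>Weyl group elements\<close>

lemma weyl_group_inj: "w \<in> weyl_group \<Phi> \<Longrightarrow> inj w"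
proof (induction rule: weyl_group.induct)
  case id
  show ?case by simp
next
  case (comp \<alpha> w)
  have "inj (refl_root \<alpha>)"
    using refl_root_involution[OF root_nonzero[OF comp(1)]] by (metis injI)
  then show ?case
    using comp.IH by (rule inj_compose)
qed

text \<open>
  An element of the Weyl group permutes the finite set of roots, so a vector that it maps to a
  root is itself a root.
\<close>

lemma vimage_neg_roots_subset:
  assumes w: "w \<in> weyl_group \<Phi>"
  shows "w -` neg_roots \<Phi> a \<subseteq> \<Phi>"
proof
  fix x assume "x \<in> w -` neg_roots \<Phi> a"
  then have wx: "w x \<in> \<Phi>"
    using neg_roots_subset by blast
  have "w ` \<Phi> = \<Phi>"
    using weyl_group_root[OF root_system w] inj_on_subset[OF weyl_group_inj[OF w] subset_UNIV]
    by (intro endo_inj_surj[OF finite_roots]) auto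
  then obtain y where "y \<in> \<Phi>" "w x = w y"
    using wx by blast
  then show "x \<in> \<Phi>"
    using weyl_group_inj[OF w] by (simp add: inj_eq)
qed

lemma admissible_weyl: "w \<in> admissible \<Phi> a p \<Longrightarrow> w \<in> weyl_group \<Phi>"
  by (simp add: admissible_def)

lemma finite_admissible: "finite (admissible \<Phi> a p)"
  using finite_weyl_group[OF root_system] by (simp add: admissible_def)

lemma id_admissible: "id \<in> admissible \<Phi> a p"
  by (auto simp: admissible_def simple_roots_except_def weyl_group.id)

section \<open>Comparison of the exponents\<close>

lemma roots_at_inversion_set:
  assumes w: "w \<in> weyl_group \<Phi>" and h: "h \<ge> 1"
  shows "roots_at \<Phi> a p (inversion_set \<Phi> a w) k h = roots_at \<Phi> a p (w -` neg_roots \<Phi> a) k h"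
  using vimage_neg_roots_subset[OF w] pos_root_of_height_pos h
  by (auto simp: roots_at_def inversion_set_def)

lemma roots_at_diff_simple:
  assumes "h \<ge> 2"
  shows "roots_at \<Phi> a p (S - simple_roots_except a p) k h = roots_at \<Phi> a p S k h"
proof -
  have "coroot_height \<Phi> a \<beta> \<noteq> of_int h" if "\<beta> \<in> simple_roots_except a p" for \<beta>
    using that coroot_height_simple assms
    by (auto simp: simple_roots_except_def simple_roots_def)
  then show ?thesis
    by (auto simp: roots_at_def)
qed

lemma term_exponent_eq:
  assumes w: "w \<in> weyl_group \<Phi>" and h: "h \<ge> 2"
  shows "- term_exponent \<Phi> a p w k h =
     int (card (roots_at \<Phi> a p (w -` neg_roots \<Phi> a) k (h - 1))) -
     int (card (roots_at \<Phi> a p (w -` neg_roots \<Phi> a) k h))"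
  using roots_at_inversion_set[OF w, of h] roots_at_inversion_set[OF w, of "h - 1"] h
  by (simp add: term_exponent_def roots_at_diff_simple)

lemma min_exponent_eq_M_exponent:
  assumes h: "h \<ge> 2"
  shows "min_exponent \<Phi> a p k h = M_exponent \<Phi> a p k h"
proof -
  let ?A = "admissible \<Phi> a p"
  let ?f = "\<lambda>w. - term_exponent \<Phi> a p w k h"
  have M: "M_exponent \<Phi> a p k h = (MAX w\<in>?A. ?f w)"
    unfolding M_exponent_def
    by (intro arg_cong[where f = Max] image_cong refl term_exponent_eq[symmetric] admissible_weyl h)
  have none: "roots_at \<Phi> a p (id -` neg_roots \<Phi> a) k h' = {}" if "h' \<ge> 1" for h'
    using that coroot_height_neg by (force simp: roots_at_def)
  \<comment> \<open>the identity shows that the maximum is not affected by truncation at 0\<close>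
  have "?f id = 0"
    using h by (simp add: term_exponent_eq[OF weyl_group.id h] none del: vimage_id)
  then have nonneg: "0 \<le> (MAX w\<in>?A. ?f w)"
    using Max_ge[of "?f ` ?A" "?f id"] finite_admissible id_admissible by simp
  have "mono (max (0::int))"
    by (auto intro: monoI)
  moreover have "?f ` ?A \<noteq> {}"
    using id_admissible by blast
  ultimately have "(MAX w\<in>?A. max 0 (?f w)) = max 0 (MAX w\<in>?A. ?f w)"
    using mono_Max_commute[of "max (0::int)" "?f ` ?A"] finite_admissible
    by (simp add: image_image)
  then show ?thesis
    using M nonneg by (simp add: min_exponent_def)
qed

lemma min_exponent_1: "min_exponent \<Phi> a p k 1 = 0"
proof -
  have "roots_at \<Phi> a p (inversion_set \<Phi> a w) k 0 = {}" for w
    using coroot_height_pos by (force simp: roots_at_def inversion_set_def)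
  then have "(\<lambda>w. max 0 (- term_exponent \<Phi> a p w k 1)) ` admissible \<Phi> a p = {0}"
    using id_admissible by (auto simp: term_exponent_def)
  then show ?thesis
    by (simp add: min_exponent_def)
qed

text \<open>
  A nonzero exponent at \<open>(k, h)\<close> requires a root at \<open>(k, h)\<close> or at
  \<open>(k, h - 1)\<close>, and a root determines its pair of values.
\<close>

lemma finite_M_exponent_support: "finite {(k, h). M_exponent \<Phi> a p k h \<noteq> 0}"
proof (rule finite_subset)
  let ?g = "\<lambda>\<beta>. (\<lfloor>fund_weight a p \<bullet> coroot \<beta>\<rfloor>, \<lfloor>coroot_height \<Phi> a \<beta>\<rfloor>)"
  let ?g1 = "\<lambda>\<beta>. (\<lfloor>fund_weight a p \<bullet> coroot \<beta>\<rfloor>, \<lfloor>coroot_height \<Phi> a \<beta>\<rfloor> + 1)"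
  show "finite (?g ` \<Phi> \<union> ?g1 ` \<Phi>)"
    using finite_roots by simp
  show "{(k, h). M_exponent \<Phi> a p k h \<noteq> 0} \<subseteq> ?g ` \<Phi> \<union> ?g1 ` \<Phi>"
  proof clarify
    fix k h
    assume nz: "M_exponent \<Phi> a p k h \<noteq> 0" and notin: "(k, h) \<notin> ?g1 ` \<Phi>"
    show "(k, h) \<in> ?g ` \<Phi>"
    proof (rule ccontr)
      assume notin': "(k, h) \<notin> ?g ` \<Phi>"
      have "roots_at \<Phi> a p (w -` neg_roots \<Phi> a) k h = {}"
        and "roots_at \<Phi> a p (w -` neg_roots \<Phi> a) k (h - 1) = {}"
        if w: "w \<in> admissible \<Phi> a p" for w
        using vimage_neg_roots_subset[OF admissible_weyl[OF w]] notin notin'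
        by (force simp: roots_at_def image_iff)+
      then have "M_exponent \<Phi> a p k h = (MAX w\<in>admissible \<Phi> a p. 0)"
        unfolding M_exponent_def by (intro arg_cong[where f = Max] image_cong) auto
      also have "(\<lambda>w. 0::int) ` admissible \<Phi> a p = {0}"
        using id_admissible by blast
      finally show False
        using nz by simp
    qed
  qed
qed

end

section \<open>The normalizing factors coincide\<close>

theorem theorem2p3:
  fixes \<Phi> :: "'a::euclidean_space set" and a :: "nat \<Rightarrow> 'a" and p :: nat
  assumes "root_system \<Phi>" and "fundamental_system \<Phi> a" and "p \<in> {1..DIM('a)}"
  shows "finite {(k, h). M_exponent \<Phi> a p k h \<noteq> 0} \<and>
    (\<forall>s T. xi_GP \<Phi> a p s T = omega_GP \<Phi> a p s T *
       (\<Prod>(k, h) \<in> {(k, h). k \<ge> 0 \<and> h \<ge> 2 \<and> M_exponent \<Phi> a p k h \<noteq> 0}.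
          xi (of_int k * s + of_int h) powi M_exponent \<Phi> a p k h))"
proof -
  interpret based_root_system \<Phi> a
    using assms by unfold_locales
  have support: "k \<ge> 0 \<and> h \<ge> 1 \<and> min_exponent \<Phi> a p k h \<noteq> 0 \<longleftrightarrow>
      k \<ge> 0 \<and> h \<ge> 2 \<and> M_exponent \<Phi> a p k h \<noteq> 0" for k h
  proof (cases "h = 1")
    case True
    then show ?thesis by (simp add: min_exponent_1)
  next
    case False
    then show ?thesis
      using min_exponent_eq_M_exponent[of h p k] by auto
  qed
  have "(\<Prod>(k, h) \<in> {(k, h). k \<ge> 0 \<and> h \<ge> 1 \<and> min_exponent \<Phi> a p k h \<noteq> 0}.
          xi (of_int k * s + of_int h) powi min_exponent \<Phi> a p k h) =
       (\<Prod>(k, h) \<in> {(k, h). k \<ge> 0 \<and> h \<ge> 2 \<and> M_exponent \<Phi> a p k h \<noteq> 0}.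
          xi (of_int k * s + of_int h) powi M_exponent \<Phi> a p k h)" for s
    unfolding support by (intro prod.cong) (auto simp: min_exponent_eq_M_exponent)
  then show ?thesis
    using finite_M_exponent_support by (simp add: xi_GP_def)
qed

end
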